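(* Let $T$ be a finite rooted ordered tree and let $T^*$ be its dual tree. Then $$\mathrm{BP}(T)=\overleftrightarrow{\mathrm{DFUDS}(T^* )},$$ where for a bitvector $B\in\{0,1\}^n$ the reversal $\overleftrightarrow{B}$ is defined by $\overleftrightarrow{B}[x]:=1-B[n-x+1]$ for all $x\in\{1,\ldots,n\}$.
   Context: Trees are finite, rooted and ordered (the children of each node are linearly ordered from left to right). Depth-first traversal order (preorder) visits a node before its descendants and visits children from left to right. For a node $u$, $rmc_T(u)$ is its rightmost child in $T$ and $ils_T(u)$ its immediate left sibling in $T$ (when these exist). Dual tree: for a tree $T$ with root $r$, $T^*$ has the same vertex set and root $r$; parents $\mathsf{pa}^*$ and the order among children in $T^*$ are determined by: (1a) $r$ has no parent in $T^*$; (1b) if $v=rmc_T(r)$ then $v=rmc_{T^*}(r)$; (2) if $v=rmc_T(u)$ with $u\ne r$, then $v$ is the immediate left sibling of $u$ in $T^*$ (so $\mathsf{pa}^*(v)=\mathsf{pa}^*(u)$); (3) if $v=ils_T(u)$, then $v$ is the rightmost child of $u$ in $T^*$ (so $\mathsf{pa}^*(v)=u$). $T^*$ is a rooted ordered tree. Parenthesis representations, written as bitvectors with '(' $=1$ and ')' $=0$: $\mathrm{BP}(T)$ is obtained by a depth-first traversal writing '(' when a node is reached for the first time and ')' when it is left (after all its descendants). $\mathrm{DFUDS}(T)$ is a single '(' followed by the concatenation, over all nodes in depth-first order, of $d$ copies of '(' and then one ')', where $d$ is the number of children of the node. *)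

theory Defs
  imports Main "HOL-Library.Z2" "HOL-Library.Multiset"
begin

text \<open>
  Vertices are the labels, so a tree is only meaningful if its labels are pairwise distinct
  (\<open>distinct_vertices\<close>); child lists are read from left to right.
\<close>

datatype 'a ordered_tree = Node (root_of: 'a) (child_trees: "'a ordered_tree list")

text \<open>The subtrees in preorder; there is exactly one for each node.\<close>

primrec dfs :: "'a ordered_tree \<Rightarrow> 'a ordered_tree list" where
  "dfs (Node v ts) = Node v ts # concat (map dfs ts)"

definition vertices :: "'a ordered_tree \<Rightarrow> 'a set" where
  "vertices T = set (map root_of (dfs T))"

definition distinct_vertices :: "'a ordered_tree \<Rightarrow> bool" where
  "distinct_vertices T \<longleftrightarrow> distinct (map root_of (dfs T))"

definition has_children :: "'a ordered_tree \<Rightarrow> 'a \<Rightarrow> 'a list \<Rightarrow> bool" where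
  "has_children T u cs \<longleftrightarrow> (\<exists>ts. Node u ts \<in> set (dfs T) \<and> cs = map root_of ts)"

text \<open>
  \<open>is_rmc T u v\<close> and \<open>is_ils T u v\<close> say that \<open>v\<close> is the rightmost child, respectively the
  immediate left sibling, of \<open>u\<close> in \<open>T\<close> (in particular, that it exists).
\<close>

definition is_rmc :: "'a ordered_tree \<Rightarrow> 'a \<Rightarrow> 'a \<Rightarrow> bool" where
  "is_rmc T u v \<longleftrightarrow> (\<exists>cs. has_children T u (cs @ [v]))"

definition is_ils :: "'a ordered_tree \<Rightarrow> 'a \<Rightarrow> 'a \<Rightarrow> bool" where
  "is_ils T u v \<longleftrightarrow> (\<exists>p cs ds. has_children T p (cs @ [v, u] @ ds))"

text \<open>
  That the root has no parent in the dual tree is part of \<open>root_of T' = root_of T\<close>, given that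
  \<open>T'\<close> has distinct vertices.
\<close>

definition is_dual_tree :: "'a ordered_tree \<Rightarrow> 'a ordered_tree \<Rightarrow> bool" where
  "is_dual_tree T T' \<longleftrightarrow>
     distinct_vertices T' \<and> vertices T' = vertices T \<and> root_of T' = root_of T \<and>
     (\<forall>v. is_rmc T (root_of T) v \<longrightarrow> is_rmc T' (root_of T) v) \<and>
     (\<forall>u v. is_rmc T u v \<and> u \<noteq> root_of T \<longrightarrow> is_ils T' u v) \<and>
     (\<forall>u v. is_ils T u v \<longrightarrow> is_rmc T' u v)"

text \<open>Well defined whenever \<open>T\<close> has distinct vertices, see \<open>dual_tree_ex1\<close> below.\<close>

definition dual_tree :: "'a ordered_tree \<Rightarrow> 'a ordered_tree" where
  "dual_tree T = (THE T'. is_dual_tree T T')"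

text \<open>Opening parentheses are \<open>1\<close>, closing parentheses are \<open>0\<close>.\<close>

primrec BP :: "'a ordered_tree \<Rightarrow> bit list" where
  "BP (Node v ts) = [1] @ concat (map BP ts) @ [0]"

definition DFUDS :: "'a ordered_tree \<Rightarrow> bit list" where
  "DFUDS T = [1] @ concat (map (\<lambda>s. replicate (length (child_trees s)) 1 @ [0]) (dfs T))"

text \<open>Lists are indexed from \<open>0\<close>, hence \<open>n - 1 - x\<close> in place of \<open>n - x + 1\<close>.\<close>

definition bv_reversal :: "bit list \<Rightarrow> bit list" where
  "bv_reversal B = map (\<lambda>x. 1 - B ! (length B - 1 - x)) [0..<length B]"


subsection \<open>Existence and uniqueness of the dual tree\<close>

lemma mset_dfs_children:
  "mset (map root_of (dfs T)) =
     add_mset (root_of T) (mset (concat (map (\<lambda>s. map root_of (child_trees s)) (dfs T))))"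
proof (induction T)
  case (Node v ts)
  have "mset (map root_of (concat (map dfs us))) =
     mset (map root_of us)
       + mset (concat (map (\<lambda>s. map root_of (child_trees s)) (concat (map dfs us))))"
    if "set us \<subseteq> set ts" for us
    using that by (induction us) (simp_all add: Node del: mset_map)
  from this[of ts] show ?case by (simp del: mset_map)
qed

lemma distinct_dfs_children:
  assumes "distinct_vertices T"
  shows "distinct (root_of T # concat (map (\<lambda>s. map root_of (child_trees s)) (dfs T)))"
  using assms unfolding distinct_vertices_def
  by (metis mset_dfs_children mset.simps(2) mset_eq_imp_distinct_iff)

lemma vertices_eq:
  "vertices T = insert (root_of T) {v. \<exists>u cs. has_children T u cs \<and> v \<in> set cs}"
proof -
  have "vertices T =
      insert (root_of T) (set (concat (map (\<lambda>s. map root_of (child_trees s)) (dfs T))))"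
    unfolding vertices_def
    by (metis mset_dfs_children mset.simps(2) mset_eq_setD list.simps(15))
  also have "set (concat (map (\<lambda>s. map root_of (child_trees s)) (dfs T))) =
      {v. \<exists>u cs. has_children T u cs \<and> v \<in> set cs}"
    (is "?L = ?R")
  proof
    show "?L \<subseteq> ?R"
    proof
      fix v assume "v \<in> ?L"
      then obtain s where "s \<in> set (dfs T)" "v \<in> set (map root_of (child_trees s))" by auto
      moreover from this have "has_children T (root_of s) (map root_of (child_trees s))"
        unfolding has_children_def by (metis ordered_tree.collapse)
      ultimately show "v \<in> ?R" by blast
    qed
    show "?R \<subseteq> ?L" unfolding has_children_def by force
  qed
  finally show ?thesis .
qed

lemma has_children_ex: "u \<in> vertices T \<Longrightarrow> \<exists>cs. has_children T u cs"
  unfolding vertices_def has_children_def by (auto, metis ordered_tree.collapse)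

lemma has_children_in_vertices: "has_children T u cs \<Longrightarrow> u \<in> vertices T"
  unfolding vertices_def has_children_def by (auto, metis image_eqI ordered_tree.sel(1))

lemma has_children_unique:
  assumes "distinct_vertices T" "has_children T u cs" "has_children T u cs'"
  shows "cs = cs'"
  using assms unfolding distinct_vertices_def has_children_def distinct_map inj_on_def
  by (metis ordered_tree.sel)

lemma has_children_distinct:
  assumes "distinct_vertices T" "has_children T u cs"
  shows "distinct cs" "root_of T \<notin> set cs"
proof -
  obtain ts where ts: "Node u ts \<in> set (dfs T)" "cs = map root_of ts"
    using assms by (auto simp: has_children_def)
  have "cs \<in> set (map (\<lambda>s. map root_of (child_trees s)) (dfs T))"
    using ts by force
  then show "distinct cs" "root_of T \<notin> set cs"
    using distinct_dfs_children[OF assms(1)] unfolding distinct.simps distinct_concat_iff set_concat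
    by blast+
qed

lemma distinct_concat_map_inj:
  "distinct (concat (map f xs)) \<Longrightarrow> x \<in> set xs \<Longrightarrow> y \<in> set xs \<Longrightarrow>
     v \<in> set (f x) \<Longrightarrow> v \<in> set (f y) \<Longrightarrow> x = y"
  by (induction xs) auto

lemma has_children_parent:
  assumes "distinct_vertices T" "has_children T u cs" "has_children T u' cs'"
    and "v \<in> set cs" "v \<in> set cs'"
  shows "u = u'"
proof -
  obtain ts where ts: "Node u ts \<in> set (dfs T)" "cs = map root_of ts"
    using assms by (auto simp: has_children_def)
  obtain ts' where ts': "Node u' ts' \<in> set (dfs T)" "cs' = map root_of ts'"
    using assms by (auto simp: has_children_def)
  have "Node u ts = Node u' ts'"
    using distinct_dfs_children[OF assms(1)] ts ts' assms(4,5)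
    by (intro distinct_concat_map_inj[of "\<lambda>s. map root_of (child_trees s)" "dfs T" _ _ v]) auto
  then show ?thesis by simp
qed

lemma dfs_trans: "s \<in> set (dfs T) \<Longrightarrow> t \<in> set (child_trees s) \<Longrightarrow> t \<in> set (dfs T)"
proof (induction T)
  case (Node v ts)
  have "x \<in> set (dfs x)" for x :: "'a ordered_tree" by (cases x) simp
  moreover have "s = Node v ts \<or> (\<exists>x\<in>set ts. s \<in> set (dfs x))" using Node.prems by auto
  ultimately show ?case using Node by fastforce
qed

lemma tree_eqI:
  assumes S': "distinct_vertices S'" and root: "root_of S = root_of S'"
    and ch: "\<And>u cs. has_children S u cs \<Longrightarrow> has_children S' u cs"
  shows "S = S'"
proof -
  have "s = s'" if "s \<in> set (dfs S)" "s' \<in> set (dfs S')" "root_of s = root_of s'" for s s'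
    using that
  proof (induction s arbitrary: s')
    case (Node v ts)
    obtain ts' where s': "s' = Node v ts'" using Node.prems by (cases s') auto
    have "has_children S v (map root_of ts)" using Node.prems by (auto simp: has_children_def)
    then have "has_children S' v (map root_of ts)" by (rule ch)
    moreover have "has_children S' v (map root_of ts')"
      using Node.prems s' by (auto simp: has_children_def)
    ultimately have eq: "map root_of ts = map root_of ts'"
      by (rule has_children_unique[OF S'])
    have len: "length ts = length ts'" using eq by (rule map_eq_imp_length_eq)
    have "ts ! i = ts' ! i" if i: "i < length ts" for i
    proof (rule Node.IH)
      show "ts ! i \<in> set ts" using i by simp
      then show "ts ! i \<in> set (dfs S)" using dfs_trans[OF Node.prems(1)] by simp
      show "ts' ! i \<in> set (dfs S')" using dfs_trans[OF Node.prems(2)] i len s' by simp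
      show "root_of (ts ! i) = root_of (ts' ! i)" using eq i len by (metis nth_map)
    qed
    then have "ts = ts'" using len by (intro nth_equalityI)
    then show ?case using s' by simp
  qed
  moreover have "x \<in> set (dfs x)" for x :: "'a ordered_tree" by (cases x) simp
  ultimately show ?thesis using root by blast
qed

lemma last_or_next:
  assumes "v \<in> set cs"
  obtains as where "cs = as @ [v]" | as u bs where "cs = as @ [v, u] @ bs"
  using assms by (metis append_Cons append_Nil list.exhaust split_list)

lemma nonroot_cases:
  assumes "v \<in> vertices T" "v \<noteq> root_of T"
  obtains u where "is_rmc T u v" | u where "is_ils T u v"
proof -
  obtain u cs where "has_children T u cs" "v \<in> set cs" using assms vertices_eq[of T] by auto
  then show thesis using that unfolding is_rmc_def is_ils_def by (metis last_or_next)
qed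

lemma pointer_in_vertices:
  assumes "distinct_vertices T" "is_rmc T u v \<or> is_ils T u v"
  shows "v \<in> vertices T" "v \<noteq> root_of T"
proof -
  obtain p cs where "has_children T p cs" "v \<in> set cs"
    using assms(2) unfolding is_rmc_def is_ils_def by fastforce
  then show "v \<in> vertices T" "v \<noteq> root_of T"
    using vertices_eq[of T] has_children_distinct(2)[OF assms(1)] by auto
qed

lemma ils_not_root:
  assumes "distinct_vertices T" "is_ils T u v"
  shows "u \<noteq> root_of T"
  using has_children_distinct(2)[OF assms(1)] assms(2) unfolding is_ils_def by fastforce

lemma distinct_next_unique:
  "distinct (as @ [v, u] @ bs) \<Longrightarrow> as @ [v, u] @ bs = as' @ [v, u'] @ bs' \<Longrightarrow> u = u'"
  by (induction as arbitrary: as') (auto simp: Cons_eq_append_conv)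

lemma distinct_prev_unique:
  "distinct (as @ [v, u] @ bs) \<Longrightarrow> as @ [v, u] @ bs = as' @ [v', u] @ bs' \<Longrightarrow> v = v'"
  by (induction as arbitrary: as') (auto simp: Cons_eq_append_conv append_eq_Cons_conv)

lemma rmc_rmc_unique:
  assumes "distinct_vertices T" "is_rmc T u v" "is_rmc T u' v"
  shows "u = u'"
  using has_children_parent[OF assms(1)] assms(2,3) unfolding is_rmc_def by fastforce

lemma ils_ils_unique:
  assumes "distinct_vertices T" "is_ils T u v" "is_ils T u' v"
  shows "u = u'"
proof -
  obtain p as bs where 1: "has_children T p (as @ [v, u] @ bs)"
    using assms(2) by (auto simp: is_ils_def)
  obtain p' as' bs' where 2: "has_children T p' (as' @ [v, u'] @ bs')"
    using assms(3) by (auto simp: is_ils_def)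
  have "p = p'" by (rule has_children_parent[OF assms(1) 1 2, of v]) auto
  then have "as @ [v, u] @ bs = as' @ [v, u'] @ bs'"
    using has_children_unique[OF assms(1) 1] 2 by simp
  then show ?thesis using has_children_distinct(1)[OF assms(1) 1] distinct_next_unique by metis
qed

lemma ils_functional:
  assumes "distinct_vertices T" "is_ils T u v" "is_ils T u v'"
  shows "v = v'"
proof -
  obtain p as bs where 1: "has_children T p (as @ [v, u] @ bs)"
    using assms(2) by (auto simp: is_ils_def)
  obtain p' as' bs' where 2: "has_children T p' (as' @ [v', u] @ bs')"
    using assms(3) by (auto simp: is_ils_def)
  have "p = p'" by (rule has_children_parent[OF assms(1) 1 2, of u]) auto
  then have "as @ [v, u] @ bs = as' @ [v', u] @ bs'"
    using has_children_unique[OF assms(1) 1] 2 by simp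
  then show ?thesis using has_children_distinct(1)[OF assms(1) 1] distinct_prev_unique by metis
qed

lemma rmc_ils_exclusive:
  assumes "distinct_vertices T" "is_rmc T u v" "is_ils T u' v"
  shows False
proof -
  obtain as where 1: "has_children T u (as @ [v])"
    using assms(2) by (auto simp: is_rmc_def)
  obtain p' as' bs' where 2: "has_children T p' (as' @ [v, u'] @ bs')"
    using assms(3) by (auto simp: is_ils_def)
  have "u = p'" by (rule has_children_parent[OF assms(1) 1 2, of v]) auto
  then have eq: "as @ [v] = as' @ [v, u'] @ bs'"
    using has_children_unique[OF assms(1) 1] 2 by simp
  then have "v = last (u' # bs')" by (metis append_Cons append_Nil last_append last_snoc list.simps(3) last.simps)
  then have "v \<in> set (u' # bs')" by (metis last_in_set list.simps(3))
  then show False using has_children_distinct(1)[OF assms(1) 2] by auto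
qed

lemma dual_rmc_iff:
  assumes T: "distinct_vertices T" and d: "is_dual_tree T S"
  shows "is_rmc S u v \<longleftrightarrow> u = root_of T \<and> is_rmc T u v \<or> is_ils T u v"
proof
  have S: "distinct_vertices S" using d by (simp add: is_dual_tree_def)
  assume r: "is_rmc S u v"
  then have "v \<in> vertices T" "v \<noteq> root_of T"
    using pointer_in_vertices[OF S] d by (auto simp: is_dual_tree_def)
  then show "u = root_of T \<and> is_rmc T u v \<or> is_ils T u v"
    using d r rmc_rmc_unique[OF S] rmc_ils_exclusive[OF S]
    by (elim nonroot_cases) (metis is_dual_tree_def)+
qed (use d in \<open>auto simp: is_dual_tree_def\<close>)

lemma dual_ils_iff:
  assumes T: "distinct_vertices T" and d: "is_dual_tree T S"
  shows "is_ils S u v \<longleftrightarrow> u \<noteq> root_of T \<and> is_rmc T u v"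
proof
  have S: "distinct_vertices S" using d by (simp add: is_dual_tree_def)
  assume r: "is_ils S u v"
  then have "v \<in> vertices T" "v \<noteq> root_of T"
    using pointer_in_vertices[OF S] d by (auto simp: is_dual_tree_def)
  then show "u \<noteq> root_of T \<and> is_rmc T u v"
    using d r ils_ils_unique[OF S] rmc_ils_exclusive[OF S] ils_not_root[OF S]
    by (elim nonroot_cases) (metis is_dual_tree_def)+
qed (use d in \<open>auto simp: is_dual_tree_def\<close>)

lemma first_child_no_ils:
  assumes S: "distinct_vertices S" and ch: "has_children S u (x # bs)"
  shows "\<not> is_ils S x y"
proof
  assume "is_ils S x y"
  then obtain p ds es where h: "has_children S p (ds @ [y, x] @ es)" by (auto simp: is_ils_def)
  have "p = u" by (rule has_children_parent[OF S h ch, of x]) auto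
  then have eq: "x # bs = ds @ [y, x] @ es" using has_children_unique[OF S ch] h by auto
  show False using eq has_children_distinct(1)[OF S h] by (cases ds) auto
qed

text \<open>A child list is recovered from its last element by following left siblings.\<close>

lemma suffix_left_siblings:
  assumes S: "distinct_vertices S" and S': "distinct_vertices S'"
    and R: "\<And>u v. is_ils S u v \<longleftrightarrow> is_ils S' u v"
    and ch: "has_children S u (as @ x # bs)" and ch': "has_children S' u' (as' @ x # bs')"
  shows "as = as'"
  using ch ch'
proof (induction as arbitrary: x bs as' bs' rule: rev_induct)
  case Nil
  show ?case
  proof (cases as' rule: rev_cases)
    case (snoc cs y)
    then have "is_ils S' x y" using Nil by (auto simp: is_ils_def)
    then show ?thesis using first_child_no_ils[OF S] R Nil by fastforce
  qed simp
next
  case (snoc y as)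
  then have i: "is_ils S x y" by (auto simp: is_ils_def)
  show ?case
  proof (cases as' rule: rev_cases)
    case Nil
    then show ?thesis using snoc.prems i R first_child_no_ils[OF S'] by fastforce
  next
    case as': (snoc cs z)
    then have "is_ils S' x z" using snoc.prems by (auto simp: is_ils_def)
    then have "is_ils S x z" using R by simp
    then have "z = y" using ils_functional[OF S] i by blast
    then show ?thesis using snoc.IH[of y "x # bs" cs "x # bs'"] snoc.prems as' by simp
  qed
qed

lemma dual_tree_unique:
  assumes T: "distinct_vertices T" and d: "is_dual_tree T S" and d': "is_dual_tree T S'"
  shows "S = S'"
proof (rule tree_eqI)
  have S: "distinct_vertices S" and S': "distinct_vertices S'"
    using d d' by (simp_all add: is_dual_tree_def)
  show "distinct_vertices S'" by (rule S')
  show "root_of S = root_of S'" using d d' by (simp add: is_dual_tree_def)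
  fix u cs
  assume ch: "has_children S u cs"
  show "has_children S' u cs"
  proof (cases cs rule: rev_cases)
    case Nil
    have "u \<in> vertices S'"
      using has_children_in_vertices[OF ch] d d' by (simp add: is_dual_tree_def)
    then obtain cs' where ch': "has_children S' u cs'" using has_children_ex by metis
    show ?thesis
    proof (cases cs' rule: rev_cases)
      case (snoc as x)
      then have "is_rmc S' u x" using ch' by (auto simp: is_rmc_def)
      then have "is_rmc S u x" using dual_rmc_iff[OF T] d d' by simp
      then show ?thesis using has_children_unique[OF S ch] Nil by (auto simp: is_rmc_def)
    qed (use ch' Nil in simp)
  next
    case (snoc as x)
    then have "is_rmc S u x" using ch by (auto simp: is_rmc_def)
    then have "is_rmc S' u x" using dual_rmc_iff[OF T] d d' by simp
    then obtain as' where ch': "has_children S' u (as' @ [x])" by (auto simp: is_rmc_def)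
    have "as = as'"
      by (rule suffix_left_siblings[OF S S' _ _ ch'])
        (use dual_ils_iff[OF T] d d' ch snoc in auto)
    then show ?thesis using ch' snoc by simp
  qed
qed

text \<open>
  A recursive construction of the dual tree, where \<open>dual_forest\<close> expects the list of trees of
  a forest in right-to-left order.
\<close>

function dual_forest :: "'a ordered_tree list \<Rightarrow> 'a ordered_tree list" where
  "dual_forest [] = []"
| "dual_forest (Node v us # ts) = dual_forest (rev us) @ [Node v (dual_forest ts)]"
  by pat_completeness auto
termination
proof (relation "measure (size_list size)", goal_cases)
  case (2 v us ts)
  have "size_list size (rev us) = size_list size us"
    by (simp add: size_list_conv_sum_list rev_map[symmetric] sum_list_rev)
  then show ?case by simp
qed simp_all

definition dual_construction :: "'a ordered_tree \<Rightarrow> 'a ordered_tree" where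
  "dual_construction T = Node (root_of T) (dual_forest (rev (child_trees T)))"

definition forest_children :: "'a ordered_tree list \<Rightarrow> 'a \<Rightarrow> 'a list \<Rightarrow> bool" where
  "forest_children ts u cs \<longleftrightarrow> (\<exists>t \<in> set ts. has_children t u cs)"

definition forest_ils :: "'a ordered_tree list \<Rightarrow> 'a \<Rightarrow> 'a \<Rightarrow> bool" where
  "forest_ils ts u v \<longleftrightarrow>
     (\<exists>as bs. map root_of ts = as @ [v, u] @ bs) \<or>
     (\<exists>p as bs. forest_children ts p (as @ [v, u] @ bs))"

lemma has_children_Node:
  "has_children (Node r ts) u cs \<longleftrightarrow> u = r \<and> cs = map root_of ts \<or> forest_children ts u cs"
  by (auto simp: has_children_def forest_children_def)

lemma forest_children_simps:
  "forest_children [] u cs \<longleftrightarrow> False"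
  "forest_children (t # ts) u cs \<longleftrightarrow> has_children t u cs \<or> forest_children ts u cs"
  "forest_children (ts @ ts') u cs \<longleftrightarrow> forest_children ts u cs \<or> forest_children ts' u cs"
  "forest_children (rev ts) u cs \<longleftrightarrow> forest_children ts u cs"
  by (auto simp: forest_children_def)

lemma is_ils_Node: "is_ils (Node r ts) u v \<longleftrightarrow> forest_ils ts u v"
  unfolding is_ils_def forest_ils_def has_children_Node by metis

lemma forest_ils_append:
  assumes "forest_ils ts u v \<or> forest_ils ts' u v"
  shows "forest_ils (ts @ ts') u v"
proof -
  have "\<exists>as' bs'. map root_of (ts @ ts') = as' @ [v, u] @ bs'"
    if "map root_of ts = as @ [v, u] @ bs \<or> map root_of ts' = as @ [v, u] @ bs" for as bs
    using that
  proof
    assume "map root_of ts = as @ [v, u] @ bs"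
    then have "map root_of (ts @ ts') = as @ [v, u] @ (bs @ map root_of ts')" by simp
    then show ?thesis by blast
  next
    assume "map root_of ts' = as @ [v, u] @ bs"
    then have "map root_of (ts @ ts') = (map root_of ts @ as) @ [v, u] @ bs" by simp
    then show ?thesis by blast
  qed
  then show ?thesis using assms unfolding forest_ils_def forest_children_simps by metis
qed

lemma forest_ils_singleton: "forest_ils [Node w us] u v \<longleftrightarrow> forest_ils us u v"
proof -
  have "[w] \<noteq> as @ [v, u] @ bs" for as bs by (cases as) auto
  then show ?thesis by (simp add: forest_ils_def forest_children_simps has_children_Node) metis
qed

lemma last_dual_forest:
  "ts \<noteq> [] \<Longrightarrow> \<exists>ds. map root_of (dual_forest ts) = ds @ [root_of (hd ts)]"
  by (cases ts rule: dual_forest.cases) auto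

lemma mset_dual_forest:
  "mset (concat (map (\<lambda>t. map root_of (dfs t)) (dual_forest ts))) =
   mset (concat (map (\<lambda>t. map root_of (dfs t)) ts))"
proof (induction ts rule: dual_forest.induct)
  case (2 v us ts)
  have rev: "mset (concat (map f (rev us))) = mset (concat (map f us))"
    for f :: "'a ordered_tree \<Rightarrow> 'a list" and us
    by (induction us) simp_all
  have map: "map root_of (concat (map dfs us)) = concat (map (\<lambda>t. map root_of (dfs t)) us)"
    for us :: "'a ordered_tree list"
    by (induction us) simp_all
  show ?case using 2 by (simp add: rev map)
qed simp

lemma dual_forest_rmc:
  "forest_children ts u (cs @ [v]) \<Longrightarrow> forest_ils (dual_forest ts) u v"
proof (induction ts rule: dual_forest.induct)
  case (2 w us ts)
  consider "u = w" "cs @ [v] = map root_of us" | "forest_children us u (cs @ [v])"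
    | "forest_children ts u (cs @ [v])"
    using 2 by (auto simp: forest_children_simps has_children_Node)
  then show ?case
  proof cases
    case 1
    then have "rev us \<noteq> []" by auto
    from last_dual_forest[OF this] obtain ds
      where "map root_of (dual_forest (rev us)) = ds @ [root_of (last us)]" by (auto simp: hd_rev)
    moreover have "root_of (last us) = v" using 1 by (metis last_map last_snoc map_is_Nil_conv snoc_eq_iff_butlast)
    ultimately show ?thesis using 1 by (auto simp: forest_ils_def)
  next
    case 2
    then have "forest_ils (dual_forest (rev us)) u v"
      using "2.IH" by (simp add: forest_children_simps)
    then show ?thesis by (simp add: forest_ils_append)
  next
    case 3
    then have "forest_ils (dual_forest ts) u v" using "2.IH" by simp
    then show ?thesis by (simp add: forest_ils_append forest_ils_singleton)
  qed
qed (simp add: forest_children_simps)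

lemma dual_forest_ils:
  "forest_ils (rev ts) u v \<Longrightarrow> \<exists>cs. forest_children (dual_forest ts) u (cs @ [v])"
proof (induction ts rule: dual_forest.induct)
  case (2 w us ts)
  consider "u = w" "\<exists>as. map root_of (rev ts) = as @ [v]" | "forest_ils us u v"
    | "forest_ils (rev ts) u v"
  proof -
    have "u = w \<and> (\<exists>as. map root_of (rev ts) = as @ [v]) \<or> forest_ils (rev ts) u v"
      if "map root_of (rev ts) @ [w] = as @ [v, u] @ bs" for as bs
    proof (cases bs rule: rev_cases)
      case (snoc cs x)
      then have "map root_of (rev ts) = as @ [v, u] @ cs" using that by simp
      then show ?thesis unfolding forest_ils_def by blast
    qed (use that in auto)
    moreover have "(\<exists>as bs. map root_of (rev ts) @ [w] = as @ [v, u] @ bs) \<or>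
        forest_ils us u v \<or> forest_ils (rev ts) u v"
    proof -
      have "(\<exists>as bs. map root_of (rev ts @ [Node w us]) = as @ [v, u] @ bs) \<or>
          (\<exists>p as bs. forest_children (rev ts @ [Node w us]) p (as @ [v, u] @ bs))"
        using "2.prems" unfolding forest_ils_def by simp
      then show ?thesis
        unfolding forest_ils_def forest_children_simps has_children_Node
        by (simp del: append.simps) metis
    qed
    ultimately show thesis using that by blast
  qed
  then show ?case
  proof cases
    case 1
    then obtain as where as: "map root_of (rev ts) = as @ [v]" by blast
    then have "ts \<noteq> []" by auto
    moreover have "root_of (hd ts) = v"
      using as by (metis \<open>ts \<noteq> []\<close> last_map last_rev last_snoc rev_is_Nil_conv)
    ultimately show ?thesis using last_dual_forest[of ts] 1
      by (auto simp: forest_children_simps has_children_Node)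
  next
    case 2
    then show ?thesis using "2.IH" by (auto simp: forest_children_simps)
  next
    case 3
    then show ?thesis using "2.IH" by (auto simp: forest_children_simps has_children_Node)
  qed
qed (simp add: forest_ils_def forest_children_simps)

lemma is_dual_tree_construction:
  assumes T: "distinct_vertices T"
  shows "is_dual_tree T (dual_construction T)"
proof -
  obtain r ts where Tr: "T = Node r ts" by (cases T)
  let ?S = "Node r (dual_forest (rev ts))"
  have S: "dual_construction T = ?S" by (simp add: dual_construction_def Tr)
  have map: "map root_of (concat (map dfs us)) = concat (map (\<lambda>t. map root_of (dfs t)) us)"
    for us :: "'a ordered_tree list"
    by (induction us) simp_all
  have rev: "mset (concat (map f (rev us))) = mset (concat (map f us))"
    for f :: "'a ordered_tree \<Rightarrow> 'a list" and us
    by (induction us) simp_all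
  have m: "mset (map root_of (dfs ?S)) = mset (map root_of (dfs T))"
    using mset_dual_forest[of "rev ts"] by (simp add: Tr map rev del: mset_map)
  have "distinct_vertices ?S"
    using T mset_eq_imp_distinct_iff[OF m] by (simp add: distinct_vertices_def)
  moreover have "vertices ?S = vertices T"
    using mset_eq_setD[OF m] by (simp add: vertices_def)
  moreover have "is_rmc ?S r v" if rmc: "is_rmc T r v" for v
  proof -
    obtain cs where cs: "has_children T r (cs @ [v])" using rmc by (auto simp: is_rmc_def)
    then have eq: "cs @ [v] = map root_of ts"
      using has_children_unique[OF T] by (auto simp: Tr has_children_Node)
    then have "rev ts \<noteq> []" by auto
    moreover have "root_of (last ts) = v"
      using eq by (metis last_map last_snoc map_is_Nil_conv snoc_eq_iff_butlast)
    ultimately show ?thesis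
      using last_dual_forest[of "rev ts"] by (auto simp: is_rmc_def has_children_Node hd_rev)
  qed
  moreover have "is_ils ?S u v" if "is_rmc T u v" "u \<noteq> r" for u v
    using that dual_forest_rmc[of "rev ts" u _ v]
    by (auto simp: is_rmc_def is_ils_Node Tr has_children_Node forest_children_simps)
  moreover have "is_rmc ?S u v" if "is_ils T u v" for u v
    using that dual_forest_ils[of "rev ts" u v]
    by (auto simp: is_rmc_def is_ils_Node Tr has_children_Node)
  ultimately show ?thesis unfolding is_dual_tree_def S by (simp add: Tr)
qed

theorem dual_tree_ex1: "distinct_vertices T \<Longrightarrow> \<exists>!S. is_dual_tree T S"
  using is_dual_tree_construction dual_tree_unique by blast

lemma is_dual_tree_dual_tree: "distinct_vertices T \<Longrightarrow> is_dual_tree T (dual_tree T)"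
  unfolding dual_tree_def by (rule theI') (rule dual_tree_ex1)

lemma dual_tree_eq_construction: "distinct_vertices T \<Longrightarrow> dual_tree T = dual_construction T"
  using is_dual_tree_dual_tree is_dual_tree_construction dual_tree_unique by metis

end

theory Submission imports Defs begin

text \<open>
  Read the dual forest of a forest off the recursion \<open>dual_forest\<close>, which consumes the trees from
  right to left. With \<open>k\<close> trees in the dual forest, the reversed unary degree sequence of the dual
  forest followed by \<open>1 0\<^sup>k\<close> (the reversed code of a node that has this forest as its children)
  is \<open>1\<close> followed by the balanced parentheses of the original forest. This invariant passes through
  one recursion step by using it once for the remaining trees and once for the children.
\<close>

lemma bv_reversal_eq: "bv_reversal B = rev (map (\<lambda>b. 1 - b) B)"
  by (rule nth_equalityI) (simp_all add: bv_reversal_def rev_nth)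

lemma bv_reversal_simps [simp]:
  "bv_reversal [] = []"
  "bv_reversal (b # B) = bv_reversal B @ [1 - b]"
  "bv_reversal (B @ C) = bv_reversal C @ bv_reversal B"
  "bv_reversal (replicate n b) = replicate n (1 - b)"
  by (simp_all add: bv_reversal_eq)

abbreviation degree_codes :: "'a ordered_tree list \<Rightarrow> bit list" where
  "degree_codes ts \<equiv>
     concat (map (\<lambda>s. replicate (length (child_trees s)) 1 @ [0]) (concat (map dfs ts)))"

lemma BP_forest_dual:
  "1 # concat (map BP (rev ts)) =
     bv_reversal (degree_codes (dual_forest ts)) @ [1] @ replicate (length (dual_forest ts)) 0"
proof (induction ts rule: dual_forest.induct)
  case (2 v us ts)
  \<comment> \<open>The opening parenthesis of \<open>v\<close> doubles as the leading
    \<open>1\<close> of the invariant for its children \<open>us\<close>.\<close>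
  have "1 # concat (map BP (rev (Node v us # ts))) =
      (1 # concat (map BP (rev ts))) @ (1 # concat (map BP (rev (rev us)))) @ [0]"
    by simp
  also have "\<dots> = bv_reversal (degree_codes (dual_forest (Node v us # ts))) @ [1] @
      replicate (length (dual_forest (Node v us # ts))) 0"
    \<comment> \<open>The \<open>1\<close> and zeros from \<open>ts\<close> form the reversed code
      of \<open>v\<close> in the dual; the closing \<open>0\<close> of \<open>v\<close> counts
      \<open>v\<close> as one more dual tree.\<close>
    unfolding 2 by (simp add: replicate_append_same)
  finally show ?case .
qed simp

theorem theorem1:
  fixes T :: "'a ordered_tree"
  assumes "distinct_vertices T"
  shows "BP T = bv_reversal (DFUDS (dual_tree T))"
proof (cases T)
  case (Node r ts)
  \<comment> \<open>The double \<open>rev\<close> matches the invariant at \<open>rev ts\<close>.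
    The final \<open>0\<close> is the reversed initial \<open>1\<close> of
    \<open>DFUDS\<close>.\<close>
  have "BP T = (1 # concat (map BP (rev (rev ts)))) @ [0]" by (simp add: Node)
  also have "\<dots> = bv_reversal (DFUDS (dual_construction T))"
    unfolding BP_forest_dual by (simp add: Node dual_construction_def DFUDS_def)
  finally show ?thesis using dual_tree_eq_construction[OF assms] by simp
qed

end
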